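(* Let $N\ge1$, $s\in(0,1)$, let $\Omega\subset\mathbb{R}^N$ be an open set, let $c\in L^\infty(\Omega)$, and let $u\in H^s_0(\Omega)\cap C(\mathbb{R}^N)$ be such that $u=0$ in $\mathbb{R}^N\setminus\Omega$ and $u^-\in L^\infty(\Omega)$. Let $x_0\in\partial\Omega$. Suppose that $\Omega$ satisfies an interior ball condition at $x_0$, i.e. there is a ball $B_R(y_0)\subset\Omega$ with $x_0\in\partial B_R(y_0)$, and suppose that there exists a ball $B_\delta(x_0)$, $\delta>0$, such that $u\ge0$ in $B_\delta(x_0)\cap\Omega$. Let $U$ be the Caffarelli-Silvestre extension of $u$. If $u$ satisfies Hopf's Lemma at $x_0$, that is, if for every $\beta\in\left(0,\frac{\pi}{2}\right)$ $$\liminf_{\substack{x\to x_0\\ x\in C_\beta(x_0)}}\frac{u(x)}{|x-x_0|^s}>0,$$ then $$\lim_{t\to0^+}\frac{U(x_0,t)-U(x_0,0)}{t^{2s}}=+\infty,$$ and, therefore, $U$ satisfies Hopf's Lemma in the sense that $\displaystyle\liminf_{t\to0^+}\frac{U(x_0,t)-U(x_0,0)}{t^{2s}}>0$.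
   Context: $u^-(x):=\max\{-u(x),0\}$. $H^s(\mathbb{R}^N)$ is the space of $u\in L^2(\mathbb{R}^N)$ with finite Gagliardo seminorm $[u]_{H^s(\mathbb{R}^N)}=\left(\int_{\mathbb{R}^N}\int_{\mathbb{R}^N}\frac{|u(x)-u(y)|^2}{|x-y|^{N+2s}}\,dx\,dy\right)^{1/2}$. $H^s_0(\Omega)$ is the closure of $C^\infty_c(\Omega)$ with respect to the Gagliardo seminorm (functions extended by $0$ outside $\Omega$); $u$ is regarded as an element of $H^s(\mathbb{R}^N)$. With $B_R(y_0)$ the interior ball at $x_0$, for $\beta\in\left(0,\frac{\pi}{2}\right)$, $$C_\beta(x_0):=\left\{x\in\Omega\,\Big|\,\arccos\left(\frac{x-x_0}{|x-x_0|}\cdot\frac{y_0-x_0}{|y_0-x_0|}\right)<\beta\right\}.$$ The Caffarelli-Silvestre extension of $u\in H^s(\mathbb{R}^N)$ is the solution $U$ on $\mathbb{R}^{N+1}_+=\mathbb{R}^N\times\mathbb{R}^+$ of $\operatorname{div}(t^{1-2s}\nabla U)=0$ in $\mathbb{R}^{N+1}_+$, $U(x,0)=u(x)$ in $\mathbb{R}^N$; it is given for $t>0$ by $$U(x,t)=P_{N,s}\int_{\mathbb{R}^N}\frac{u(y)\,t^{2s}}{(|x-y|^2+t^2)^{\frac{N+2s}{2}}}\,dy,\qquad P_{N,s}=\pi^{-\frac N2}\frac{\Gamma\left(\frac{N+2s}{2}\right)}{\Gamma(s)}.$$ *)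

theory Defs
  imports "HOL-Analysis.Analysis"
begin

text \<open>The space \<open>\<real>\<^sup>N\<close> is \<^typ>\<open>real ^ 'n\<close> with \<open>N = CARD('n)\<close>, so \<open>N \<ge> 1\<close> is automatic.
  All integrals are with respect to the (complete) Lebesgue measure, which makes the function
  spaces below invariant under modification on null sets.\<close>

definition neg_part :: "('a \<Rightarrow> real) \<Rightarrow> 'a \<Rightarrow> real" where
  "neg_part u x = max (- u x) 0"

definition Linfty :: "(real ^ 'n) set \<Rightarrow> ((real ^ 'n) \<Rightarrow> real) set" where
  "Linfty \<Omega> = {f. f \<in> borel_measurable (lebesgue_on \<Omega>) \<and>
                   (\<exists>M. AE x in lebesgue_on \<Omega>. \<bar>f x\<bar> \<le> M)}"

text \<open>On the diagonal the integrand is \<open>0 / 0 = 0\<close>; the diagonal is a null set.\<close>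

definition gagliardo_energy :: "real \<Rightarrow> ((real ^ 'n) \<Rightarrow> real) \<Rightarrow> ennreal" where
  "gagliardo_energy s u =
     (\<integral>\<^sup>+ x. (\<integral>\<^sup>+ y. ennreal (\<bar>u x - u y\<bar>\<^sup>2 / norm (x - y) powr (real CARD('n) + 2 * s))
        \<partial>lebesgue) \<partial>lebesgue)"

definition gagliardo_seminorm :: "real \<Rightarrow> ((real ^ 'n) \<Rightarrow> real) \<Rightarrow> ennreal" where
  "gagliardo_seminorm s u =
     (if gagliardo_energy s u = \<infinity> then \<infinity>
      else ennreal (sqrt (enn2real (gagliardo_energy s u))))"

definition Hs :: "real \<Rightarrow> ((real ^ 'n) \<Rightarrow> real) set" where
  "Hs s = {u. u \<in> borel_measurable lebesgue \<and> integrable lebesgue (\<lambda>x. (u x)\<^sup>2) \<and>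
              gagliardo_seminorm s u < \<infinity>}"

primrec C_k :: "nat \<Rightarrow> ((real ^ 'n) \<Rightarrow> real) \<Rightarrow> bool" where
  "C_k 0 f \<longleftrightarrow> continuous_on UNIV f"
| "C_k (Suc k) f \<longleftrightarrow> (\<forall>x. f differentiable (at x)) \<and>
     (\<forall>i. C_k k (\<lambda>x. frechet_derivative f (at x) (axis i 1)))"

text \<open>Test functions on \<open>\<Omega>\<close>, already extended by \<open>0\<close> to the whole space.\<close>

definition Cc_infty :: "(real ^ 'n) set \<Rightarrow> ((real ^ 'n) \<Rightarrow> real) set" where
  "Cc_infty \<Omega> = {\<phi>. (\<forall>k. C_k k \<phi>) \<and> compact (closure {x. \<phi> x \<noteq> 0}) \<and>
                     closure {x. \<phi> x \<noteq> 0} \<subseteq> \<Omega>}"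

text \<open>The closure of the test functions is taken inside \<^term>\<open>Hs s\<close>, on which the Gagliardo seminorm
  vanishes only for null functions.\<close>

definition Hs0 :: "real \<Rightarrow> (real ^ 'n) set \<Rightarrow> ((real ^ 'n) \<Rightarrow> real) set" where
  "Hs0 s \<Omega> = {u \<in> Hs s. \<forall>\<epsilon>>0. \<exists>\<phi> \<in> Cc_infty \<Omega>.
                 gagliardo_seminorm s (\<lambda>x. u x - \<phi> x) < ennreal \<epsilon>}"

text \<open>The cone with vertex \<open>x\<^sub>0\<close> and half-opening \<open>\<beta>\<close> around the direction from \<open>x\<^sub>0\<close> to
  the centre \<open>y\<^sub>0\<close> of the interior ball.\<close>

definition cone_at ::
    "(real ^ 'n) set \<Rightarrow> real ^ 'n \<Rightarrow> real ^ 'n \<Rightarrow> real \<Rightarrow> (real ^ 'n) set" where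
  "cone_at \<Omega> y0 x0 \<beta> =
     {x \<in> \<Omega>. arccos (((x - x0) /\<^sub>R norm (x - x0)) \<bullet> ((y0 - x0) /\<^sub>R norm (y0 - x0))) < \<beta>}"

definition P_const :: "nat \<Rightarrow> real \<Rightarrow> real" where
  "P_const N s = pi powr (- (real N / 2)) * (Gamma ((real N + 2 * s) / 2) / Gamma s)"

text \<open>The Caffarelli-Silvestre extension, given by its Poisson formula for \<open>t > 0\<close> (the equation
  \<open>div (t\<^bsup>1-2s\<^esup> \<nabla>U) = 0\<close> with trace \<open>u\<close> alone does not determine \<open>U\<close>, since \<open>t\<^bsup>2s\<^esup>\<close> is a solution
  with zero trace) and by the trace \<open>u\<close> at \<open>t = 0\<close>. Values at \<open>t < 0\<close> are irrelevant.\<close>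

definition CS_extension :: "real \<Rightarrow> ((real ^ 'n) \<Rightarrow> real) \<Rightarrow> real ^ 'n \<Rightarrow> real \<Rightarrow> real" where
  "CS_extension s u x t =
     (if t > 0
      then P_const CARD('n) s *
           (\<integral>y. u y * t powr (2 * s) /
                 ((norm (x - y))\<^sup>2 + t\<^sup>2) powr ((real CARD('n) + 2 * s) / 2) \<partial>lebesgue)
      else u x)"

end

theory Submission
  imports Defs
begin

text \<open>Since \<open>x\<^sub>0 \<notin> \<Omega>\<close>, the trace vanishes at \<open>x\<^sub>0\<close>, and the difference quotient is exactly
  \<open>P\<^sub>N\<^sub>,\<^sub>s \<integral> u(y) / (|x\<^sub>0 - y|\<^sup>2 + t\<^sup>2)\<^bsup>(N+2s)/2\<^esup> dy\<close>. This integral tends to infinity because a single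
  ball already makes it do so, while everything negative stays bounded.

  Write \<open>e\<close> for the unit vector from \<open>x\<^sub>0\<close> towards \<open>y\<^sub>0\<close>. For small \<open>t\<close> the ball of radius \<open>t/4\<close>
  around \<open>x\<^sub>0 + t e\<close> lies in the interior ball and, seen from \<open>x\<^sub>0\<close>, within the angle \<open>\<pi>/3\<close> of the
  axis (\<open>ball_on_axis_subset_cone\<close>). On it \<open>|y - x\<^sub>0|\<close> is comparable to \<open>t\<close>, so Hopf's lemma gives
  \<open>u \<ge> const \<cdot> t\<^sup>s\<close>, whereas the kernel is at least \<open>const \<cdot> t\<^bsup>-N-2s\<^esup>\<close> and the volume is
  \<open>const \<cdot> t\<^sup>N\<close>. The ball thus contributes at least \<open>const \<cdot> t\<^bsup>-s\<^esup>\<close>.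

  On the rest of \<open>B\<^sub>\<delta>(x\<^sub>0)\<close> the integrand is nonnegative. Outside \<open>B\<^sub>\<delta>(x\<^sub>0)\<close> the kernel is at most
  \<open>|x\<^sub>0 - y|\<^bsup>-N-2s\<^esup>\<close>, uniformly in \<open>t\<close>, and this is square integrable there because \<open>2(N + 2s) > N\<close>
  (\<open>integrable_max_norm_powr\<close>); as \<open>u\<close> is square integrable too, Young's inequality
  (\<open>abs_mult_kernel_le\<close>) bounds the contribution independently of \<open>t\<close>. The two estimates are combined
  in \<open>kernel_integral_tendsto_infinity\<close>.\<close>

section \<open>The Poisson kernel against square integrable functions\<close>

text \<open>The cut-off at \<open>r\<close> removes the singularity, so only decay at infinity matters. On the dyadic
  shell \<open>2\<^sup>k r \<le> |x - y| < 2\<^bsup>k+1\<^esup> r\<close> the function is at most \<open>(2\<^sup>k r)\<^bsup>-q\<^esup>\<close> and the volume is at most a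
  multiple of \<open>2\<^bsup>kN\<^esup>\<close>, where \<open>N\<close> is the dimension; as \<open>q > N\<close> the shells are dominated by a geometric series.\<close>

lemma integrable_max_norm_powr:
  fixes x :: "'a::euclidean_space"
  assumes "0 < r" and q: "real DIM('a) < q"
  shows "integrable lebesgue (\<lambda>y. max r (norm (x - y)) powr (- q))"
proof -
  let ?d = "DIM('a)"
  define b where "b k = (2 ^ k * r) powr (- q)" for k :: nat
  define v where "v = unit_ball_vol (real ?d) * (2 * r) ^ ?d * r powr (- q)"
  define \<rho> where "\<rho> = (2::real) powr (real ?d - q)"
  have meas: "(\<lambda>y. max r (norm (x - y)) powr (- q)) \<in> borel_measurable lebesgue"
    by (intro measurable_completion) measurable
  have le_suminf: "F k \<le> (\<Sum>k. F k)" for F :: "nat \<Rightarrow> ennreal" and k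
    using sum_le_suminf[of F "{k}"] by simp
  have "(\<integral>\<^sup>+y. ennreal (max r (norm (x - y)) powr (- q)) \<partial>lebesgue)
      \<le> (\<integral>\<^sup>+y. (\<Sum>k. ennreal (b k) * indicator (cball x (2 ^ Suc k * r)) y) \<partial>lebesgue)"
  proof (rule nn_integral_mono)
    fix y
    define m where "m = max r (norm (x - y))"
    \<comment> \<open>The inner ball \<open>|x - y| < r\<close>, where \<open>m = r\<close>, falls under \<open>k = 0\<close>.\<close>
    have "1 \<le> m / r" using \<open>0 < r\<close> by (simp add: m_def)
    then have "1 \<le> nat \<lfloor>m / r\<rfloor>" by (simp add: le_nat_iff)
    then obtain k where "2 ^ k \<le> nat \<lfloor>m / r\<rfloor>" "nat \<lfloor>m / r\<rfloor> < 2 ^ Suc k"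
      using ex_power_ivl1[of 2 "nat \<lfloor>m / r\<rfloor>"] by auto
    then have k: "2 ^ k \<le> m / r" "m / r < 2 ^ Suc k"
      using \<open>1 \<le> m / r\<close> by (auto simp: le_nat_iff nat_less_iff le_floor_iff floor_less_iff)
    have "ennreal (m powr (- q)) \<le> ennreal (b k)"
      unfolding b_def using k \<open>0 < r\<close> q
      by (intro ennreal_leI powr_mono2') (auto simp: field_simps)
    also have "\<dots> = ennreal (b k) * indicator (cball x (2 ^ Suc k * r)) y"
      using k \<open>0 < r\<close> by (auto simp: m_def dist_norm field_simps indicator_def)
    also have "\<dots> \<le> (\<Sum>k. ennreal (b k) * indicator (cball x (2 ^ Suc k * r)) y)"
      by (rule le_suminf)
    finally show "ennreal (max r (norm (x - y)) powr (- q)) \<le> \<dots>" by (simp add: m_def)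
  qed
  also have "\<dots> = (\<Sum>k. \<integral>\<^sup>+y. ennreal (b k) * indicator (cball x (2 ^ Suc k * r)) y \<partial>lebesgue)"
    by (intro nn_integral_suminf borel_measurable_times_ennreal borel_measurable_const
        borel_measurable_indicator) simp
  also have "\<dots> = (\<Sum>k. ennreal (v * \<rho> ^ k))"
  proof (intro suminf_cong)
    fix k :: nat
    have "(\<integral>\<^sup>+y. ennreal (b k) * indicator (cball x (2 ^ Suc k * r)) y \<partial>lebesgue)
        = ennreal (b k) * ennreal (unit_ball_vol (real ?d) * (2 ^ Suc k * r) ^ ?d)"
      using \<open>0 < r\<close> by (subst nn_integral_cmult_indicator) (simp_all add: emeasure_cball)
    also have "\<dots> = ennreal (b k * (unit_ball_vol (real ?d) * (2 ^ Suc k * r) ^ ?d))"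
      using \<open>0 < r\<close> by (simp add: ennreal_mult b_def)
    also have "b k * (unit_ball_vol (real ?d) * (2 ^ Suc k * r) ^ ?d) = v * \<rho> ^ k"
    proof -
      have "b k = ((2 powr (- q)) ^ k) * r powr (- q)"
        using \<open>0 < r\<close> by (simp add: b_def powr_mult powr_realpow[symmetric] powr_powr mult.commute)
      moreover have "\<rho> = 2 ^ ?d * 2 powr (- q)"
        by (simp add: \<rho>_def powr_realpow[symmetric] powr_add[symmetric])
      moreover have "(2 ^ Suc k * r) ^ ?d = (2 * r) ^ ?d * (2 ^ ?d) ^ k"
        by (simp add: power_mult_distrib power_mult[symmetric] mult.commute)
      ultimately show ?thesis by (simp add: v_def power_mult_distrib)
    qed
    finally show "(\<integral>\<^sup>+y. ennreal (b k) * indicator (cball x (2 ^ Suc k * r)) y \<partial>lebesgue)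
        = ennreal (v * \<rho> ^ k)" .
  qed
  also have "\<dots> < \<infinity>"
  proof -
    have "\<rho> < 1" "0 \<le> \<rho>" using q by (simp_all add: \<rho>_def powr_less_one)
    then have "summable (\<lambda>k. v * \<rho> ^ k)" by (intro summable_mult summable_geometric) simp
    moreover have "0 \<le> v * \<rho> ^ k" for k
      using \<open>0 < r\<close> \<open>0 \<le> \<rho>\<close> by (simp add: v_def)
    ultimately show ?thesis by (simp add: suminf_ennreal2)
  qed
  finally show ?thesis
    using meas by (intro integrableI_nonneg) auto
qed

lemma power2_powr_half:
  fixes m q :: real
  assumes "0 < m"
  shows "(m\<^sup>2) powr (q / 2) = m powr q"
proof -
  have "m\<^sup>2 = m powr 2" using assms by simp
  then show ?thesis by (simp only: powr_powr) simp
qed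

text \<open>The alternative \<open>r \<le> a \<or> r \<le> t\<close> covers the two uses of one bound: \<open>r = \<delta>\<close> away from the
  singularity, uniformly in \<open>t\<close>, and \<open>r = t\<close> everywhere, for integrability at fixed \<open>t\<close>.\<close>

lemma kernel_le_max_powr:
  fixes r q a t :: real
  assumes "0 < r" "0 \<le> q" "0 \<le> a" "0 \<le> t" "r \<le> a \<or> r \<le> t"
  shows "1 / (a\<^sup>2 + t\<^sup>2) powr (q / 2) \<le> max r a powr (- q)"
proof -
  have m: "0 < max r a" using assms by simp
  have "(max r a)\<^sup>2 \<le> a\<^sup>2 + t\<^sup>2"
    using assms power_mono[of r t 2] by (auto simp: max_def intro: add_increasing power_mono)
  then have "((max r a)\<^sup>2) powr (q / 2) \<le> (a\<^sup>2 + t\<^sup>2) powr (q / 2)"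
    using assms by (intro powr_mono2) auto
  also have "((max r a)\<^sup>2) powr (q / 2) = max r a powr q"
    using m by (rule power2_powr_half)
  finally show ?thesis
    using m by (simp add: powr_minus_divide frac_le)
qed

text \<open>Young's inequality turns the product into a sum of two terms that are separately integrable
  when \<open>f\<close> runs through the values of a square integrable function.\<close>

lemma abs_mult_kernel_le:
  fixes r q a t f :: real
  assumes "0 < r" "0 \<le> q" "0 \<le> a" "0 \<le> t" "r \<le> a \<or> r \<le> t"
  shows "\<bar>f / (a\<^sup>2 + t\<^sup>2) powr (q / 2)\<bar> \<le> (f\<^sup>2 + max r a powr (- (2 * q))) / 2"
proof -
  define g where "g = max r a powr (- q)"
  have "\<bar>f / (a\<^sup>2 + t\<^sup>2) powr (q / 2)\<bar> = \<bar>f\<bar> * (1 / (a\<^sup>2 + t\<^sup>2) powr (q / 2))" by (simp add: abs_divide)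
  also have "\<dots> \<le> \<bar>f\<bar> * g"
    unfolding g_def by (intro mult_left_mono kernel_le_max_powr assms) auto
  also have "\<dots> \<le> (f\<^sup>2 + g\<^sup>2) / 2"
    using sum_squares_bound[of "\<bar>f\<bar>" g] by simp
  also have "g\<^sup>2 = max r a powr (- (2 * q))"
    by (simp add: g_def power2_eq_square powr_add[symmetric])
  finally show ?thesis .
qed

lemma integrable_mult_kernel:
  fixes u :: "'a::euclidean_space \<Rightarrow> real"
  assumes u: "u \<in> borel_measurable lebesgue" and u2: "integrable lebesgue (\<lambda>y. (u y)\<^sup>2)"
    and "0 < t" and q: "real DIM('a) < 2 * q"
  shows "integrable lebesgue (\<lambda>y. u y / ((norm (x - y))\<^sup>2 + t\<^sup>2) powr (q / 2))"
proof (rule Bochner_Integration.integrable_bound)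
  show "integrable lebesgue (\<lambda>y. ((u y)\<^sup>2 + max t (norm (x - y)) powr (- (2 * q))) / 2)"
    using integrable_max_norm_powr[OF \<open>0 < t\<close> q] u2 by simp
  have "(\<lambda>y. ((norm (x - y))\<^sup>2 + t\<^sup>2) powr (q / 2)) \<in> borel_measurable lebesgue"
    by (intro measurable_completion) measurable
  then show "(\<lambda>y. u y / ((norm (x - y))\<^sup>2 + t\<^sup>2) powr (q / 2)) \<in> borel_measurable lebesgue"
    using u by measurable
  have "0 \<le> q" using q by (smt (verit) of_nat_0_le_iff)
  then have "\<bar>u y / ((norm (x - y))\<^sup>2 + t\<^sup>2) powr (q / 2)\<bar>
      \<le> ((u y)\<^sup>2 + max t (norm (x - y)) powr (- (2 * q))) / 2" for y
    using \<open>0 < t\<close> by (intro abs_mult_kernel_le) auto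
  then show "AE y in lebesgue. norm (u y / ((norm (x - y))\<^sup>2 + t\<^sup>2) powr (q / 2))
      \<le> norm (((u y)\<^sup>2 + max t (norm (x - y)) powr (- (2 * q))) / 2)"
    unfolding real_norm_def by (intro AE_I2 order_trans[OF _ abs_ge_self])
qed

section \<open>Balls of size comparable to their distance from the vertex\<close>

lemma ball_on_axis_bounds:
  fixes e x0 x :: "'a::euclidean_space"
  assumes "norm e = 1" "0 < t" "x \<in> ball (x0 + t *\<^sub>R e) (t / 4)"
  shows "3 * t / 4 \<le> norm (x - x0)" "norm (x - x0) \<le> 5 * t / 4" "3 * t / 4 \<le> (x - x0) \<bullet> e"
proof -
  define w where "w = x - (x0 + t *\<^sub>R e)"
  have w: "norm w < t / 4" using assms(3) by (simp add: w_def dist_norm norm_minus_commute)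
  have x: "x - x0 = t *\<^sub>R e + w" by (simp add: w_def)
  have ee: "e \<bullet> e = 1" using assms(1) by (simp add: norm_eq_1)
  have "\<bar>w \<bullet> e\<bar> \<le> norm w" using Cauchy_Schwarz_ineq2[of w e] assms(1) by simp
  then show 1: "3 * t / 4 \<le> (x - x0) \<bullet> e" using w ee by (simp add: x inner_add_left)
  show "norm (x - x0) \<le> 5 * t / 4"
    unfolding x using norm_triangle_ineq[of "t *\<^sub>R e" w] w assms by simp
  show "3 * t / 4 \<le> norm (x - x0)"
    using norm_cauchy_schwarz[of "x - x0" e] 1 assms(1) by simp
qed

text \<open>The centre \<open>x\<^sub>0 + t e\<close> has distance \<open>R - t\<close> from \<open>y\<^sub>0\<close>, so even the ball of radius \<open>t\<close> would be
  contained in \<open>B\<^sub>R(y\<^sub>0)\<close>; the factor \<open>1/4\<close> is what keeps it inside a narrow cone.\<close>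

lemma ball_on_axis_subset_ball:
  fixes x0 y0 :: "'a::euclidean_space"
  assumes R: "norm (y0 - x0) = R" and "0 < t" "t \<le> R"
  shows "ball (x0 + t *\<^sub>R ((y0 - x0) /\<^sub>R R)) (t / 4) \<subseteq> ball y0 R"
proof -
  have "0 < R" using assms by simp
  have "y0 - (x0 + t *\<^sub>R ((y0 - x0) /\<^sub>R R)) = (1 - t / R) *\<^sub>R (y0 - x0)"
    by (simp add: algebra_simps divide_inverse)
  then have "dist (x0 + t *\<^sub>R ((y0 - x0) /\<^sub>R R)) y0 = \<bar>1 - t / R\<bar> * R"
    using R by (simp add: dist_norm norm_minus_commute)
  also have "\<dots> = R - t" using assms \<open>0 < R\<close> by (simp add: abs_if field_simps)
  finally show ?thesis using \<open>0 < t\<close> by (auto simp: ball_subset_ball_iff)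
qed

text \<open>In the ball the axial component of \<open>x - x\<^sub>0\<close> is at least \<open>3t/4\<close> and its length at most \<open>5t/4\<close>,
  so the cosine of the angle to the axis is at least \<open>3/5 > 1/2 = cos (\<pi>/3)\<close>.\<close>

lemma ball_on_axis_subset_cone:
  fixes x0 y0 :: "real ^ 'n"
  assumes R: "norm (y0 - x0) = R" and "0 < t" "t \<le> R" and sub: "ball y0 R \<subseteq> \<Omega>"
  shows "ball (x0 + t *\<^sub>R ((y0 - x0) /\<^sub>R R)) (t / 4) \<subseteq> cone_at \<Omega> y0 x0 (pi / 3)"
proof
  define e where "e = (y0 - x0) /\<^sub>R R"
  fix x assume x: "x \<in> ball (x0 + t *\<^sub>R ((y0 - x0) /\<^sub>R R)) (t / 4)"
  have "0 < R" using assms by simp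
  then have e: "norm e = 1" using R by (simp add: e_def)
  note b = ball_on_axis_bounds[OF e \<open>0 < t\<close> x[folded e_def]]
  define v where "v = ((x - x0) /\<^sub>R norm (x - x0)) \<bullet> e"
  have n: "0 < norm (x - x0)" using b \<open>0 < t\<close> by linarith
  have v: "v = ((x - x0) \<bullet> e) / norm (x - x0)" by (simp add: v_def divide_inverse mult.commute)
  have "norm (x - x0) < 2 * ((x - x0) \<bullet> e)" using b \<open>0 < t\<close> by linarith
  then have "1 / 2 < v" using n by (simp add: v field_simps)
  moreover have "v \<le> 1" using n norm_cauchy_schwarz[of "x - x0" e] e by (simp add: v)
  ultimately have "arccos v < arccos (1 / 2)" by (intro arccos_less_arccos) auto
  then have "arccos v < pi / 3" by simp
  moreover have "x \<in> \<Omega>" using x ball_on_axis_subset_ball[OF R] assms by blast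
  ultimately show "x \<in> cone_at \<Omega> y0 x0 (pi / 3)"
    by (simp add: cone_at_def v_def e_def R)
qed

section \<open>Blow-up of the difference quotient\<close>

lemma Liminf_pos_at_withinD:
  fixes f :: "'a::metric_space \<Rightarrow> real"
  assumes "0 < Liminf (at a within S) (\<lambda>x. ereal (f x))"
  obtains c d where "0 < c" "0 < d" "\<And>x. x \<in> S \<Longrightarrow> x \<noteq> a \<Longrightarrow> dist x a < d \<Longrightarrow> c < f x"
proof -
  obtain c where c: "0 < ereal c" "ereal c < Liminf (at a within S) (\<lambda>x. ereal (f x))"
    using ereal_dense2[OF assms] by auto
  then have "\<forall>\<^sub>F x in at a within S. ereal c < ereal (f x)"
    using le_Liminf_iff[of "Liminf (at a within S) (\<lambda>x. ereal (f x))" "at a within S"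
        "\<lambda>x. ereal (f x)"] by blast
  then show ?thesis using that c by (auto simp: eventually_at)
qed

lemma Liminf_pos_if_filterlim_at_top:
  fixes f :: "'a \<Rightarrow> real"
  assumes "filterlim f at_top F"
  shows "0 < Liminf F (\<lambda>t. ereal (f t))"
proof -
  have "\<forall>\<^sub>F t in F. 1 \<le> ereal (f t)"
    using assms by (auto simp: filterlim_at_top elim: eventually_mono)
  then have "1 \<le> Liminf F (\<lambda>t. ereal (f t))" by (rule Liminf_bounded)
  then show ?thesis by (rule less_le_trans[rotated]) simp
qed

text \<open>The integrand is at least \<open>m t\<close> times the indicator of the ball \<open>B t\<close>, minus a fixed
  integrable function \<open>h\<close> that accounts for the possibly negative part outside \<open>B\<^sub>\<delta>(x\<^sub>0)\<close>. The powers
  of \<open>t\<close> in \<open>m t\<close> and in the volume of \<open>B t\<close> combine to \<open>s - (N + 2s) + N = -s\<close>.\<close>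

lemma kernel_integral_tendsto_infinity:
  fixes u :: "'a::euclidean_space \<Rightarrow> real"
  assumes "0 < s"
    and u: "u \<in> borel_measurable lebesgue" and u2: "integrable lebesgue (\<lambda>y. (u y)\<^sup>2)"
    and "0 < \<delta>" and nonneg: "\<And>y. y \<in> ball x0 \<delta> \<Longrightarrow> 0 \<le> u y"
    and e: "norm e = 1" and "0 < c" "0 < T"
    and growth: "\<And>t y. 0 < t \<Longrightarrow> t < T \<Longrightarrow> y \<in> ball (x0 + t *\<^sub>R e) (t / 4) \<Longrightarrow>
      c * norm (y - x0) powr s \<le> u y"
  shows "filterlim (\<lambda>t. \<integral>y. u y / ((norm (x0 - y))\<^sup>2 + t\<^sup>2) powr ((real DIM('a) + 2 * s) / 2) \<partial>lebesgue)
    at_top (at_right 0)"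
proof -
  define q where "q = real DIM('a) + 2 * s"
  define K where "K t y = ((norm (x0 - y))\<^sup>2 + t\<^sup>2) powr (q / 2)" for t y
  define h where "h y = ((u y)\<^sup>2 + max \<delta> (norm (x0 - y)) powr (- (2 * q))) / 2" for y
  define B where "B t = ball (x0 + t *\<^sub>R e) (t / 4)" for t
  \<comment> \<open>On \<open>B t\<close> the distance to \<open>x\<^sub>0\<close> lies between \<open>3t/4\<close> and \<open>5t/4\<close>, and \<open>(5/4)\<^sup>2 + 1 \<le> 3\<close>.\<close>
  define m where "m t = c * (3 * t / 4) powr s / (3 * t\<^sup>2) powr (q / 2)" for t
  define A where "A = c * (3 / 4) powr s / 3 powr (q / 2) * unit_ball_vol (real DIM('a)) / 4 ^ DIM('a)"
  have q: "0 < q" "real DIM('a) < 2 * q"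
    using \<open>0 < s\<close> by (simp_all add: q_def)
  have h: "integrable lebesgue h"
    unfolding h_def using integrable_max_norm_powr[OF \<open>0 < \<delta>\<close> q(2)] u2 by simp
  have h0: "0 \<le> h y" for y by (simp add: h_def)
  have lower: "A * t powr (- s) - integral\<^sup>L lebesgue h \<le> (\<integral>y. u y / K t y \<partial>lebesgue)"
    if t: "0 < t" "t < T" for t
  proof -
    have pt: "m t * indicator (B t) y - h y \<le> u y / K t y" for y
    proof (cases "y \<in> B t")
      case True
      note b = ball_on_axis_bounds[OF e \<open>0 < t\<close> True[unfolded B_def]]
      have "(norm (x0 - y))\<^sup>2 \<le> (5 * t / 4)\<^sup>2"
        using b by (intro power_mono) (auto simp: norm_minus_commute)
      also have "\<dots> \<le> 2 * t\<^sup>2" by (simp add: power2_eq_square)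
      finally have "K t y \<le> (3 * t\<^sup>2) powr (q / 2)"
        unfolding K_def using q by (intro powr_mono2) auto
      moreover have "c * (3 * t / 4) powr s \<le> c * norm (y - x0) powr s"
        using b t \<open>0 < c\<close> \<open>0 < s\<close> by (intro mult_left_mono powr_mono2) auto
      moreover have "0 < K t y" unfolding K_def using t by (simp add: add_nonneg_pos)
      moreover have "c * norm (y - x0) powr s \<le> u y"
        using growth[of t y] True t by (simp add: B_def)
      moreover have "0 \<le> c * (3 * t / 4) powr s" using \<open>0 < c\<close> by simp
      ultimately have "m t \<le> u y / K t y"
        unfolding m_def by (intro frac_le) linarith+
      with True h0[of y] show ?thesis by simp
    next
      case False
      show ?thesis
      proof (cases "y \<in> ball x0 \<delta>")
        case True
        then have "0 \<le> u y / K t y" using nonneg[of y] by (simp add: K_def)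
        with False h0[of y] show ?thesis by simp
      next
        case out: False
        then have "\<bar>u y / K t y\<bar> \<le> h y"
          unfolding K_def h_def using t q \<open>0 < \<delta>\<close>
          by (intro abs_mult_kernel_le) (auto simp: dist_norm)
        then have "- h y \<le> u y / K t y" by linarith
        with False show ?thesis by simp
      qed
    qed
    have "A * t powr (- s) = m t * measure lebesgue (B t)"
    proof -
      have "(3 * t\<^sup>2) powr (q / 2) = 3 powr (q / 2) * t powr q"
        using t by (simp add: powr_mult power2_powr_half)
      moreover have "t powr q = t ^ DIM('a) * t powr s * t powr s"
        using t powr_add[of t s s] by (simp add: q_def powr_add powr_realpow)
      moreover have "(3 * t / 4) powr s = (3 / 4) powr s * t powr s"
        using t by (simp add: powr_mult powr_divide)
      ultimately show ?thesis
        using t by (simp add: A_def m_def B_def content_ball powr_minus power_divide field_simps)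
    qed
    also have "m t * measure lebesgue (B t) - integral\<^sup>L lebesgue h
        = (\<integral>y. m t * indicator (B t) y - h y \<partial>lebesgue)"
      using h t by (subst Bochner_Integration.integral_diff) (auto simp: B_def emeasure_ball)
    also have "\<dots> \<le> (\<integral>y. u y / K t y \<partial>lebesgue)"
    proof (rule integral_mono)
      show "integrable lebesgue (\<lambda>y. m t * indicator (B t) y - h y)"
        using h t by (intro Bochner_Integration.integrable_diff) (auto simp: B_def emeasure_ball)
      show "integrable lebesgue (\<lambda>y. u y / K t y)"
        unfolding K_def using integrable_mult_kernel[OF u u2 \<open>0 < t\<close> q(2)] .
    qed (rule pt)
    finally show ?thesis by simp
  qed
  have "0 < A" using \<open>0 < c\<close> by (simp add: A_def)
  have "filterlim (\<lambda>t::real. t powr (- s)) at_top (at_right 0)"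
  proof (rule filterlim_cong[THEN iffD1, OF refl refl])
    show "\<forall>\<^sub>F t::real in at_right 0. exp (s * (- ln t)) = t powr (- s)"
      by (rule eventually_mono[OF eventually_at_right_less]) (simp add: powr_def)
    have "filterlim (\<lambda>t::real. - ln t) at_top (at_right 0)"
      using ln_at_0 by (simp add: filterlim_uminus_at_bot)
    then show "filterlim (\<lambda>t::real. exp (s * (- ln t))) at_top (at_right 0)"
      using \<open>0 < s\<close> by (intro filterlim_compose[OF exp_at_top]
          filterlim_tendsto_pos_mult_at_top[OF tendsto_const])
  qed
  then have "filterlim (\<lambda>t. - integral\<^sup>L lebesgue h + A * t powr (- s)) at_top (at_right 0)"
    using \<open>0 < A\<close>
    by (intro filterlim_tendsto_add_at_top[OF tendsto_const] filterlim_tendsto_pos_mult_at_top[OF tendsto_const])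
  then show ?thesis
  proof (rule filterlim_at_top_mono)
    have "\<forall>\<^sub>F t in at_right 0. t \<in> {0<..<T}"
      using \<open>0 < T\<close> by (intro eventually_at_right_real)
    then show "\<forall>\<^sub>F t in at_right 0. - integral\<^sup>L lebesgue h + A * t powr (- s)
        \<le> (\<integral>y. u y / ((norm (x0 - y))\<^sup>2 + t\<^sup>2) powr ((real DIM('a) + 2 * s) / 2) \<partial>lebesgue)"
      by eventually_elim (use lower in \<open>auto simp: K_def q_def\<close>)
  qed
qed

theorem theorem3p5:
  fixes s R \<delta> :: real
    and \<Omega> :: "(real ^ 'n) set"
    and c u :: "real ^ 'n \<Rightarrow> real"
    and x0 y0 :: "real ^ 'n"
  assumes "0 < s" "s < 1"
    and "open \<Omega>"
    and "c \<in> Linfty \<Omega>"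
    and "u \<in> Hs0 s \<Omega>"
    and "continuous_on UNIV u"
    and "\<And>x. x \<notin> \<Omega> \<Longrightarrow> u x = 0"
    and "neg_part u \<in> Linfty \<Omega>"
    and "x0 \<in> frontier \<Omega>"
    and "0 < R" "ball y0 R \<subseteq> \<Omega>" "x0 \<in> frontier (ball y0 R)"
    and "0 < \<delta>" "\<And>x. x \<in> ball x0 \<delta> \<inter> \<Omega> \<Longrightarrow> 0 \<le> u x"
    and hopf: "\<And>\<beta>. 0 < \<beta> \<Longrightarrow> \<beta> < pi / 2 \<Longrightarrow>
      Liminf (at x0 within cone_at \<Omega> y0 x0 \<beta>) (\<lambda>x. ereal (u x / norm (x - x0) powr s)) > 0"
  shows "filterlim (\<lambda>t. (CS_extension s u x0 t - CS_extension s u x0 0) / t powr (2 * s))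
           at_top (at_right 0)
       \<and> Liminf (at_right 0)
           (\<lambda>t. ereal ((CS_extension s u x0 t - CS_extension s u x0 0) / t powr (2 * s))) > 0"
proof -
  have u: "u \<in> borel_measurable lebesgue" and u2: "integrable lebesgue (\<lambda>y. (u y)\<^sup>2)"
    using assms(5) by (auto simp: Hs0_def Hs_def)
  have "x0 \<notin> \<Omega>" using assms(3,9) by (simp add: frontier_def interior_open)
  then have ux0: "u x0 = 0" using assms(7) by simp
  have R: "norm (y0 - x0) = R" using assms(10,12) by (simp add: dist_norm)
  define e where "e = (y0 - x0) /\<^sub>R R"
  have e: "norm e = 1" using R \<open>0 < R\<close> by (simp add: e_def)
  \<comment> \<open>The opening angle \<open>\<pi>/3\<close> is wide enough to contain the balls on the axis.\<close>
  obtain k d where kd: "0 < k" "0 < d"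
    and k: "\<And>x. x \<in> cone_at \<Omega> y0 x0 (pi / 3) \<Longrightarrow> x \<noteq> x0 \<Longrightarrow> dist x x0 < d
              \<Longrightarrow> k < u x / norm (x - x0) powr s"
    using Liminf_pos_at_withinD[OF hopf[of "pi / 3"]] by auto
  \<comment> \<open>\<open>t < d/2\<close> ensures \<open>|y - x\<^sub>0| \<le> 5t/4 < d\<close>, the range in which the Hopf bound is available.\<close>
  have growth: "k * norm (y - x0) powr s \<le> u y"
    if t: "0 < t" "t < min R (d / 2)" and y: "y \<in> ball (x0 + t *\<^sub>R e) (t / 4)" for t y
  proof -
    note b = ball_on_axis_bounds[OF e \<open>0 < t\<close> y]
    have "y \<in> cone_at \<Omega> y0 x0 (pi / 3)"
      using ball_on_axis_subset_cone[OF R \<open>0 < t\<close> _ assms(11)] t y by (auto simp: e_def)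
    moreover have "y \<noteq> x0" using b(1) t by auto
    moreover have "dist y x0 < d" using b(2) t by (simp add: dist_norm)
    ultimately have "k < u y / norm (y - x0) powr s" by (rule k)
    then show ?thesis using \<open>y \<noteq> x0\<close> by (simp add: field_simps)
  qed
  have nonneg: "0 \<le> u y" if "y \<in> ball x0 \<delta>" for y
    using that assms(7,14) by (cases "y \<in> \<Omega>") auto
  have T: "0 < min R (d / 2)" using \<open>0 < R\<close> \<open>0 < d\<close> by simp
  define I where "I t = (\<integral>y. u y / ((norm (x0 - y))\<^sup>2 + t\<^sup>2) powr ((real CARD('n) + 2 * s) / 2) \<partial>lebesgue)" for t
  have "filterlim I at_top (at_right 0)"
    unfolding I_def
    using kernel_integral_tendsto_infinity[OF \<open>0 < s\<close> u u2 \<open>0 < \<delta>\<close> nonneg e \<open>0 < k\<close> T growth]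
    by simp
  moreover have P: "0 < P_const CARD('n) s"
    using \<open>0 < s\<close> by (auto simp: P_const_def intro!: divide_pos_pos Gamma_real_pos add_nonneg_pos)
  ultimately have "filterlim (\<lambda>t. P_const CARD('n) s * I t) at_top (at_right 0)"
    by (intro filterlim_tendsto_pos_mult_at_top[OF tendsto_const])
  moreover have "\<forall>\<^sub>F t in at_right 0. P_const CARD('n) s * I t
      = (CS_extension s u x0 t - CS_extension s u x0 0) / t powr (2 * s)"
  proof (rule eventually_mono[OF eventually_at_right_less])
    fix t :: real assume "0 < t"
    have "(\<integral>y. u y * t powr (2 * s) / ((norm (x0 - y))\<^sup>2 + t\<^sup>2) powr ((real CARD('n) + 2 * s) / 2) \<partial>lebesgue)
        = t powr (2 * s) * I t"
      unfolding I_def by (subst integral_mult_right_zero[symmetric]) (simp add: mult.commute)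
    with \<open>0 < t\<close> ux0 show "P_const CARD('n) s * I t
        = (CS_extension s u x0 t - CS_extension s u x0 0) / t powr (2 * s)"
      by (simp add: CS_extension_def)
  qed
  ultimately have "filterlim (\<lambda>t. (CS_extension s u x0 t - CS_extension s u x0 0) / t powr (2 * s))
      at_top (at_right 0)"
    by (rule filterlim_mono_eventually[OF _ order_refl order_refl])
  then show ?thesis using Liminf_pos_if_filterlim_at_top by blast
qed

end
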